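(* Let $(Y_n)_{n\ge1}$ be a sequence of real random variables defined on the same probability space, with $\liminf_{n\to+\infty}|Y_n|=0$ almost surely. Then: (a) There exists a (deterministic) sequence of positive numbers $(g_n)_{n\ge1}$ increasing to infinity with $\liminf_{n\to+\infty}g_n|Y_n|=0$ almost surely. (b) If $\sum_{n=1}^{+\infty}\mathbb{P}(Y_n=0)<+\infty$, then there exists a (deterministic) sequence of positive numbers $(g_n)_{n\ge1}$ increasing to infinity with $\lim_{n\to+\infty}g_n|Y_n|=+\infty$ almost surely.
   Context: "Increasing to infinity" means nondecreasing with limit $+\infty$. *)

theory Defs
  imports "HOL-Probability.Probability"
begin

end

(*
Both parts are Borel-Cantelli arguments. For (a), split the indices into consecutive blocks, the
k-th one so long that with probability at least 1 - 2^(-k) some |Y n| in it is below 1/(k+1)^2, and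
let g equal k+1 on that block. For (b), pick d n > 0 with P(|Y n| < d n) <= P(Y n = 0) + 2^(-n);
almost surely |Y n| >= d n eventually, so any g with g n >= n / d n will do.
*)
theory Submission
  imports Defs
begin

lemma liminf_ereal_abs_nonzero:
  fixes y :: "nat \<Rightarrow> real"
  assumes "e > 0" and "\<And>n. n \<ge> m \<Longrightarrow> e \<le> \<bar>y n\<bar>"
  shows "liminf (\<lambda>n. ereal \<bar>y n\<bar>) \<noteq> 0"
proof -
  have "ereal e \<le> liminf (\<lambda>n. ereal \<bar>y n\<bar>)"
    using assms by (intro Liminf_bounded eventually_sequentiallyI[of m]) auto
  with \<open>e > 0\<close> show ?thesis
    by (metis ereal_less(2) not_le)
qed

text \<open>One small value of \<open>z\<close> beyond each \<open>m k\<close> is enough: a positive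
  liminf would keep \<open>z\<close> eventually above some \<open>c > 0\<close>, while
  \<open>b k\<close> drops below \<open>c\<close>. In part (a) \<open>m k\<close> is the start of
  block \<open>k\<close>, so a single good index per block suffices.\<close>

lemma liminf_ereal_eq_0I:
  fixes z b :: "nat \<Rightarrow> real" and m :: "nat \<Rightarrow> nat"
  assumes nonneg: "\<And>n. 0 \<le> z n" and b: "b \<longlonglongrightarrow> 0"
    and m: "filterlim m at_top sequentially"
    and ex: "eventually (\<lambda>k. \<exists>n\<ge>m k. z n < b k) sequentially"
  shows "liminf (\<lambda>n. ereal (z n)) = 0"
proof (rule antisym)
  show "0 \<le> liminf (\<lambda>n. ereal (z n))"
    using nonneg by (intro Liminf_bounded) auto
  show "liminf (\<lambda>n. ereal (z n)) \<le> 0"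
  proof (rule ccontr)
    assume "\<not> ?thesis"
    then have "0 < liminf (\<lambda>n. ereal (z n))" by (simp add: not_le)
    from ereal_dense2[OF this]
    obtain c where c: "0 < ereal c" "ereal c < liminf (\<lambda>n. ereal (z n))" by blast
    have "eventually (\<lambda>n. c < z n) sequentially"
      using less_LiminfD[OF c(2)] by simp
    \<comment> \<open>The lower bound is made uniform over the whole tail from \<open>m k\<close>,
      because the position of the witness in \<open>ex\<close> is unknown.\<close>
    then have "eventually (\<lambda>k. \<forall>n\<ge>m k. c < z n) sequentially"
      using eventually_compose_filterlim[OF eventually_all_ge_at_top m] by blast
    moreover have "eventually (\<lambda>k. b k < c) sequentially"
      using c(1) by (intro order_tendstoD(2)[OF b]) auto
    ultimately have "eventually (\<lambda>k. False) sequentially"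
      using ex by eventually_elim force
    then show False by simp
  qed
qed

text \<open>As the block lengthens, these events decrease to the event that the absolute values stay
  at least \<open>e\<close> from \<open>m\<close> on. There the liminf is nonzero, so the limit
  event is null, and continuity from above makes the probability small for some finite
  \<open>N\<close>.\<close>

lemma (in prob_space) abs_bounded_below_block:
  fixes Y :: "nat \<Rightarrow> 'a \<Rightarrow> real"
  assumes Y: "\<And>n. n \<ge> m \<Longrightarrow> Y n \<in> borel_measurable M"
    and lim: "AE \<omega> in M. liminf (\<lambda>n. ereal \<bar>Y n \<omega>\<bar>) = 0"
    and "e > 0" "d > 0"
  shows "\<exists>N>m. prob {\<omega> \<in> space M. \<forall>n\<in>{m..<N}. e \<le> \<bar>Y n \<omega>\<bar>} < d"
proof -
  define B where "B j = {\<omega> \<in> space M. \<forall>n\<in>{m..<m + j}. e \<le> \<bar>Y n \<omega>\<bar>}" for j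
  have "{\<omega> \<in> space M. e \<le> \<bar>Y n \<omega>\<bar>} \<in> sets M" if "n \<ge> m" for n
    using Y[OF that] by measurable
  then have meas: "B j \<in> sets M" for j
    unfolding B_def by (intro sets.sets_Collect_finite_All) auto
  have "(\<lambda>j. prob (B j)) \<longlonglongrightarrow> prob (\<Inter>j. B j)"
    using meas by (intro finite_Lim_measure_decseq) (force simp: decseq_def B_def)+
  moreover have "AE \<omega> in M. \<omega> \<notin> (\<Inter>j. B j)"
    using lim
  proof eventually_elim
    case (elim \<omega>)
    have "e \<le> \<bar>Y n \<omega>\<bar>" if "\<omega> \<in> (\<Inter>j. B j)" "n \<ge> m" for n
    proof -
      have "\<omega> \<in> B (Suc n)" using that by blast
      with that show ?thesis by (auto simp: B_def)
    qed
    with elim liminf_ereal_abs_nonzero[OF \<open>e > 0\<close>, of m "\<lambda>n. Y n \<omega>"] show ?case by blast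
  qed
  then have "prob (\<Inter>j. B j) = 0"
    using meas by (subst prob_eq_0) auto
  ultimately have "eventually (\<lambda>j. prob (B j) < d) sequentially"
    using \<open>d > 0\<close> order_tendstoD(2)[of _ 0] by simp
  \<comment> \<open>Requiring \<open>j > 0\<close> makes the block nonempty, so that the block
    starts built from this lemma increase strictly.\<close>
  then have "eventually (\<lambda>j. prob (B j) < d \<and> j > 0) sequentially"
    using eventually_gt_at_top by eventually_elim auto
  then obtain j where "prob (B j) < d" "j > 0"
    using eventually_happens'[OF sequentially_bot] by blast
  then show ?thesis
    unfolding B_def by (intro exI[of _ "m + j"]) auto
qed

lemma (in prob_space) ex_scaling_liminf_zero:
  fixes Y :: "nat \<Rightarrow> 'a \<Rightarrow> real"
  assumes Y: "\<And>n. n \<ge> 1 \<Longrightarrow> Y n \<in> borel_measurable M"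
    and lim: "AE \<omega> in M. liminf (\<lambda>n. ereal \<bar>Y n \<omega>\<bar>) = 0"
  shows "\<exists>g :: nat \<Rightarrow> real. (\<forall>n\<ge>1. g n > 0) \<and> mono_on {1..} g \<and> filterlim g at_top sequentially \<and>
            (AE \<omega> in M. liminf (\<lambda>n. ereal (g n * \<bar>Y n \<omega>\<bar>)) = 0)"
proof -
  \<comment> \<open>The failure event of block \<open>k\<close>. The threshold is squared because
    one factor \<open>k + 1\<close> will be absorbed by \<open>g\<close>, leaving a bound that still
    tends to 0.\<close>
  define A where "A k a b = {\<omega> \<in> space M. \<forall>n\<in>{a..<b}. 1 / (real k + 1)^2 \<le> \<bar>Y n \<omega>\<bar>}" for k a b
  have "\<exists>N>a. prob (A k a N) < (1/2)^k" if "a \<ge> 1" for k a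
    unfolding A_def using that by (intro abs_bounded_below_block Y lim) auto
  then obtain N where N: "\<And>k a. a \<ge> 1 \<Longrightarrow> a < N a k \<and> prob (A k a (N a k)) < (1/2)^k"
    by metis
  \<comment> \<open>Block \<open>k\<close> is \<open>{m k..<m (Suc k)}\<close>. The first block
    starts at 1 since measurability of \<open>Y n\<close> is assumed only from there.\<close>
  define m where "m = rec_nat 1 (\<lambda>k a. N a k)"
  have m_simps: "m 0 = 1" "m (Suc k) = N (m k) k" for k
    by (simp_all add: m_def)
  have m_pos: "m k \<ge> 1" for k
  proof (induction k)
    case (Suc k)
    then show ?case using N[of "m k" k] by (simp add: m_simps)
  qed (simp add: m_simps)
  have m_step: "m k < m (Suc k)" and A_small: "prob (A k (m k) (m (Suc k))) < (1/2)^k" for k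
    using N[OF m_pos] by (simp_all add: m_simps)
  have m_mono: "strict_mono m"
    using m_step by (simp add: strict_mono_Suc_iff)
  \<comment> \<open>These are the blocks that have begun by index \<open>n\<close>. Their number is
    \<open>k + 1\<close> throughout block \<open>k\<close>, and monotonicity of \<open>g\<close>
    reduces to inclusion of these sets.\<close>
  define J where "J n = {k. m k \<le> n}" for n
  have J_sub: "J n \<subseteq> {..k}" if "n < m (Suc k)" for n k
  proof
    fix i assume "i \<in> J n"
    then have "m i < m (Suc k)" using that by (simp add: J_def)
    then show "i \<in> {..k}" using strict_mono_less[OF m_mono, of i "Suc k"] by simp
  qed
  \<comment> \<open>Strict monotonicity gives \<open>m (Suc n) \<ge> Suc n > n\<close>, so
    \<open>J n\<close> lies in \<open>{..n}\<close>.\<close>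
  have J_fin: "finite (J n)" for n
    using J_sub[of n n] strict_mono_imp_increasing[OF m_mono, of "Suc n"]
    by (meson finite_atMost finite_subset less_le_trans lessI)
  define g where "g n = real (card (J n))" for n
  have g_ge: "real k + 1 \<le> g n" if "m k \<le> n" for k n
  proof -
    have "{..k} \<subseteq> J n"
      using that strict_mono_less_eq[OF m_mono] by (auto simp: J_def intro: order_trans)
    from card_mono[OF J_fin this] show ?thesis by (simp add: g_def)
  qed
  have g_le: "g n \<le> real k + 1" if "n < m (Suc k)" for k n
    using card_mono[OF finite_atMost J_sub[OF that]] by (simp add: g_def)
  have "g n > 0" if "n \<ge> 1" for n
    using g_ge[of 0 n] that by (simp add: m_simps)
  moreover have "mono_on {1..} g"
    unfolding g_def by (intro mono_onI of_nat_mono card_mono J_fin) (auto simp: J_def)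
  moreover have "filterlim g at_top sequentially"
    unfolding filterlim_at_top
  proof
    fix Z :: real
    obtain k where "Z \<le> real k" using real_arch_simple by blast
    with g_ge[of k] show "eventually (\<lambda>n. Z \<le> g n) sequentially"
      by (intro eventually_sequentiallyI[of "m k"]) force
  qed
  moreover have "AE \<omega> in M. liminf (\<lambda>n. ereal (g n * \<bar>Y n \<omega>\<bar>)) = 0"
  proof -
    have "{\<omega> \<in> space M. e \<le> \<bar>Y n \<omega>\<bar>} \<in> sets M" if "n \<ge> m k" for e n k
      using Y[of n] m_pos[of k] that by (intro borel_measurable_le) auto
    then have meas: "A k (m k) b \<in> sets M" for k b
      unfolding A_def by (intro sets.sets_Collect_finite_All) auto
    have "summable (\<lambda>k. prob (A k (m k) (m (Suc k))))"
      using A_small by (intro summable_comparison_test'[OF summable_geometric[of "1/2::real"]])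
        (auto intro: less_imp_le)
    \<comment> \<open>By Borel-Cantelli, almost surely all but finitely many blocks contain an index
      where the absolute value is below the threshold.\<close>
    then have "AE \<omega> in M. eventually (\<lambda>k. \<omega> \<in> space M - A k (m k) (m (Suc k))) sequentially"
      using meas by (intro borel_cantelli_AE1) (auto simp: less_top[symmetric])
    then show ?thesis
    proof eventually_elim
      case (elim \<omega>)
      show ?case
      proof (rule liminf_ereal_eq_0I[where m = m and b = "\<lambda>k. 1 / (real k + 1)"])
        show "(\<lambda>k. 1 / (real k + 1)) \<longlonglongrightarrow> 0" 
          using LIMSEQ_inverse_real_of_nat by (simp add: inverse_eq_divide add.commute)
        show "filterlim m at_top sequentially" by (rule filterlim_subseq[OF m_mono])
        show "eventually (\<lambda>k. \<exists>n\<ge>m k. g n * \<bar>Y n \<omega>\<bar> < 1 / (real k + 1)) sequentially"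
          using elim
        proof eventually_elim
          case (elim k)
          then obtain n where n: "m k \<le> n" "n < m (Suc k)" "\<bar>Y n \<omega>\<bar> < 1 / (real k + 1)^2"
            by (auto simp: A_def not_le)
          have "g n * \<bar>Y n \<omega>\<bar> \<le> (real k + 1) * \<bar>Y n \<omega>\<bar>"
            using g_le[OF n(2)] by (intro mult_right_mono) auto
          also have "\<dots> < (real k + 1) * (1 / (real k + 1)^2)"
            using n(3) by (intro mult_strict_left_mono) auto
          also have "\<dots> = 1 / (real k + 1)" by (simp add: power2_eq_square)
          finally show ?case using n(1) by blast
        qed
      qed (simp add: g_def)
    qed
  qed
  ultimately show ?thesis by blast
qed

text \<open>Continuity from above along the radii \<open>1 / (j + 1)\<close>: the events shrink to
  \<open>X = 0\<close>, since a nonzero value exceeds one of these radii in absolute value.\<close>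

lemma (in prob_space) prob_abs_less_near_zero:
  fixes X :: "'a \<Rightarrow> real"
  assumes [measurable]: "X \<in> borel_measurable M" and "e > 0"
  shows "\<exists>d>0. prob {\<omega> \<in> space M. \<bar>X \<omega>\<bar> < d} < prob {\<omega> \<in> space M. X \<omega> = 0} + e"
proof -
  define B where "B j = {\<omega> \<in> space M. \<bar>X \<omega>\<bar> < 1 / real (Suc j)}" for j
  have "decseq B"
    unfolding B_def decseq_def by (auto elim!: less_le_trans intro!: divide_left_mono)
  moreover have "range B \<subseteq> sets M" by (auto simp: B_def)
  ultimately have "(\<lambda>j. prob (B j)) \<longlonglongrightarrow> prob (\<Inter>j. B j)"
    by (intro finite_Lim_measure_decseq)
  moreover have "X \<omega> = 0" if "\<omega> \<in> (\<Inter>j. B j)" for \<omega>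
  proof (rule ccontr)
    assume "X \<omega> \<noteq> 0"
    then obtain j where "1 / real (Suc j) < \<bar>X \<omega>\<bar>"
      using reals_Archimedean[of "\<bar>X \<omega>\<bar>"] by (auto simp: inverse_eq_divide)
    moreover have "\<bar>X \<omega>\<bar> < 1 / real (Suc j)" using that by (auto simp: B_def)
    ultimately show False by simp
  qed
  then have "(\<Inter>j. B j) = {\<omega> \<in> space M. X \<omega> = 0}" by (auto simp: B_def)
  ultimately have "eventually (\<lambda>j. prob (B j) < prob {\<omega> \<in> space M. X \<omega> = 0} + e) sequentially"
    using \<open>e > 0\<close> by (intro order_tendstoD(2)) auto
  then obtain j where "prob (B j) < prob {\<omega> \<in> space M. X \<omega> = 0} + e"
    using eventually_happens'[OF sequentially_bot] by blast
  then show ?thesis unfolding B_def by (intro exI[of _ "1 / real (Suc j)"]) auto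
qed

lemma (in prob_space) ex_scaling_tendsto_infinity:
  fixes Y :: "nat \<Rightarrow> 'a \<Rightarrow> real"
  assumes Y: "\<And>n. n \<ge> 1 \<Longrightarrow> Y n \<in> borel_measurable M"
    and sm: "summable (\<lambda>n. prob {\<omega> \<in> space M. Y (Suc n) \<omega> = 0})"
  shows "\<exists>g :: nat \<Rightarrow> real. (\<forall>n\<ge>1. g n > 0) \<and> mono_on {1..} g \<and> filterlim g at_top sequentially \<and>
            (AE \<omega> in M. filterlim (\<lambda>n. g n * \<bar>Y n \<omega>\<bar>) at_top sequentially)"
proof -
  \<comment> \<open>The slack \<open>(1/2)^n\<close> is summable. The index is shifted, so
    \<open>d n\<close> belongs to \<open>Y (Suc n)\<close>, matching the series in
    \<open>sm\<close>.\<close>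
  have "\<exists>d>0. prob {\<omega> \<in> space M. \<bar>Y (Suc n) \<omega>\<bar> < d}
      < prob {\<omega> \<in> space M. Y (Suc n) \<omega> = 0} + (1/2)^n" for n
    by (intro prob_abs_less_near_zero Y) auto
  then have "\<exists>d. \<forall>n. d n > 0 \<and> prob {\<omega> \<in> space M. \<bar>Y (Suc n) \<omega>\<bar> < d n}
      < prob {\<omega> \<in> space M. Y (Suc n) \<omega> = 0} + (1/2)^n"
    by (intro choice allI)
  then obtain d where d_pos: "\<And>n. d n > 0"
    and d: "\<And>n. prob {\<omega> \<in> space M. \<bar>Y (Suc n) \<omega>\<bar> < d n}
      < prob {\<omega> \<in> space M. Y (Suc n) \<omega> = 0} + (1/2)^n"
    by blast
  \<comment> \<open>Partial sums of positive terms are monotone whatever the \<open>d j\<close> are.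
    The summand 1 forces \<open>g n \<ge> n\<close>, hence positivity and divergence, and the last
    term of \<open>g (Suc n)\<close> supplies \<open>n / d n\<close>.\<close>
  define g where "g n = (\<Sum>j<n. 1 + real j / d j)" for n
  have term_pos: "0 < 1 + real j / d j" for j
    using d_pos[of j] by (simp add: add_pos_nonneg)
  have g_mono: "mono g"
    unfolding g_def by (intro monoI sum_mono2) (auto intro: less_imp_le[OF term_pos])
  have g_ge: "real n \<le> g n" for n
    unfolding g_def using sum_mono[of "{..<n}" "\<lambda>_. 1::real" "\<lambda>j. 1 + real j / d j"] d_pos
    by (simp add: less_imp_le)
  have g_ge': "real n / d n \<le> g (Suc n)" for n
    using g_ge[of n] by (simp add: g_def)
  have "g n > 0" if "n \<ge> 1" for n
    using g_ge[of n] that by linarith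
  moreover have "mono_on {1..} g"
    using g_mono by (simp add: mono_on_def mono_def)
  moreover have "filterlim g at_top sequentially"
    by (rule filterlim_at_top_mono[OF filterlim_real_sequentially]) (simp add: g_ge)
  moreover have "AE \<omega> in M. filterlim (\<lambda>n. g n * \<bar>Y n \<omega>\<bar>) at_top sequentially"
  proof -
    have "summable (\<lambda>n. prob {\<omega> \<in> space M. \<bar>Y (Suc n) \<omega>\<bar> < d n})"
      by (rule summable_comparison_test'[OF summable_add[OF sm summable_geometric[of "1/2::real"]]])
        (use d in \<open>auto intro: less_imp_le\<close>)
    moreover have "{\<omega> \<in> space M. \<bar>Y (Suc n) \<omega>\<bar> < d n} \<in> sets M" for n
      using Y[of "Suc n"] by measurable
    ultimately have "AE \<omega> in M. eventually
        (\<lambda>n. \<omega> \<in> space M - {\<omega> \<in> space M. \<bar>Y (Suc n) \<omega>\<bar> < d n}) sequentially"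
      by (intro borel_cantelli_AE1) (auto simp: less_top[symmetric])
    then show ?thesis
    proof eventually_elim
      case (elim \<omega>)
      then have "eventually (\<lambda>n. real n \<le> g (Suc n) * \<bar>Y (Suc n) \<omega>\<bar>) sequentially"
      proof eventually_elim
        case (elim n)
        \<comment> \<open>Outside the exceptional event \<open>d n\<close> bounds the absolute value
          of \<open>Y (Suc n)\<close> from below, so the two factors can be compared
          separately.\<close>
        have "real n = real n / d n * d n" using d_pos[of n] by simp
        also have "\<dots> \<le> g (Suc n) * \<bar>Y (Suc n) \<omega>\<bar>"
          using elim g_ge'[of n] d_pos[of n] g_ge[of "Suc n"] by (intro mult_mono) auto
        finally show ?case .
      qed
      then have "filterlim (\<lambda>n. g (Suc n) * \<bar>Y (Suc n) \<omega>\<bar>) at_top sequentially"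
        by (rule filterlim_at_top_mono[OF filterlim_real_sequentially])
      then show ?case by (subst (asm) filterlim_sequentially_Suc)
    qed
  qed
  ultimately show ?thesis by blast
qed

theorem proposition1:
  fixes M :: "'a measure" and Y :: "nat \<Rightarrow> 'a \<Rightarrow> real"
  assumes "prob_space M"
    and "\<And>n. n \<ge> 1 \<Longrightarrow> Y n \<in> borel_measurable M"
    and "AE \<omega> in M. liminf (\<lambda>n. ereal \<bar>Y n \<omega>\<bar>) = 0"
  shows "(\<exists>g :: nat \<Rightarrow> real. (\<forall>n\<ge>1. g n > 0) \<and> mono_on {1..} g \<and> filterlim g at_top sequentially \<and>
            (AE \<omega> in M. liminf (\<lambda>n. ereal (g n * \<bar>Y n \<omega>\<bar>)) = 0)) \<and>
         (summable (\<lambda>n. measure M {\<omega> \<in> space M. Y (Suc n) \<omega> = 0}) \<longrightarrow>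
          (\<exists>g :: nat \<Rightarrow> real. (\<forall>n\<ge>1. g n > 0) \<and> mono_on {1..} g \<and> filterlim g at_top sequentially \<and>
            (AE \<omega> in M. filterlim (\<lambda>n. g n * \<bar>Y n \<omega>\<bar>) at_top sequentially)))"
proof -
  interpret prob_space M by (rule assms(1))
  show ?thesis
    using ex_scaling_liminf_zero[OF assms(2,3)] ex_scaling_tendsto_infinity[OF assms(2)]
    by (intro conjI impI)
qed

end
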